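(* Let $([n],\mathcal{B})$ be a $2$-$(n,b,r,k,\lambda)$ quasi-symmetric design with intersection numbers $x<y$, and let $$s=\frac{k(r-1)-x(b-1)}{y-x}.$$ (1) Let $\{e_i\}_{i=1}^n$ be the standard orthonormal basis of $\mathbb{R}^n$ and for each block $\mathcal{J}\in\mathcal{B}$ define $x_{\mathcal{J}}=\frac{1}{\sqrt{k}}\sum_{i\in\mathcal{J}}e_i$. Then $\{x_{\mathcal{J}}\}_{\mathcal{J}\in\mathcal{B}}$ is a regular two-distance frame for $\mathbb{R}^n$ at angles $x/k$ and $y/k$ with multiplicities $b-s-1$ and $s$, respectively. This frame is not tight. (2) Let $\{\varphi_i\}_{i=1}^n$ be a simplex for $\mathbb{R}^{n-1}$ and for each block $\mathcal{J}\in\mathcal{B}$ define $x_{\mathcal{J}}=\sqrt{\frac{n-1}{k(n-k)}}\sum_{i\in\mathcal{J}}\varphi_i$. Then $\{x_{\mathcal{J}}\}_{\mathcal{J}\in\mathcal{B}}$ is a balanced two-distance tight frame for $\mathbb{R}^{n-1}$ at angles $\frac{xn-k^2}{k(n-k)}$ and $\frac{yn-k^2}{k(n-k)}$ with multiplicities $b-s-1$ and $s$, respectively.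
   Context: $[n]=\{1,\dots,n\}$. A $2$-$(n,b,r,k,\lambda)$ design on $[n]$ ($2\le k<n$) is a collection $\mathcal{B}$ of $b$ $k$-element subsets (blocks) of $[n]$ such that every $2$-subset of $[n]$ is contained in exactly $\lambda\geq 1$ blocks; every point then lies in exactly $r$ blocks. It is quasi-symmetric with intersection numbers $x<y$ if any two (different) blocks intersect in either $x$ or $y$ points, with both values occurring. A simplex for $\mathbb{R}^{n-1}$ is a family of $n$ unit vectors $\{\varphi_i\}_{i=1}^n$ in $\mathbb{R}^{n-1}$ with $\langle\varphi_i,\varphi_j\rangle=-\frac{1}{n-1}$ for all $i\neq j$. A two-distance set at angles $\alpha\neq\beta$ is a finite family $\{x_i\}_{i=1}^m$ of unit vectors with $\langle x_i,x_j\rangle\in\{\alpha,\beta\}$ for $i\neq j$, both values occurring. It is regular if for each $i$ the number of $j\neq i$ with $\langle x_i,x_j\rangle=\alpha$ (resp. $\beta$) is independent of $i$; these numbers are the multiplicities of $\alpha$ and $\beta$. It is a two-distance frame for $\mathbb{R}^d$ if it spans $\mathbb{R}^d$, and tight if for some $A>0$, $\sum_i\langle v,x_i\rangle x_i=Av$ for all $v\in\mathbb{R}^d$. A family is balanced if its vectors sum to zero. *)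

theory Defs
  imports "HOL-Analysis.Analysis"
begin

section \<open>Designs\<close>

text \<open>
  Blocks form a set, so there are no repeated blocks. The last clause only names the number r;
  that such a number exists follows from the other clauses, see \<open>replication_number_exists\<close>.
\<close>

definition two_design :: "nat \<Rightarrow> nat set set \<Rightarrow> nat \<Rightarrow> nat \<Rightarrow> nat \<Rightarrow> nat \<Rightarrow> bool" where
  "two_design n \<B> b r k l \<longleftrightarrow>
     2 \<le> k \<and> k < n \<and> 1 \<le> l \<and>
     card \<B> = b \<and>
     (\<forall>J\<in>\<B>. J \<subseteq> {1..n} \<and> card J = k) \<and>
     (\<forall>T. T \<subseteq> {1..n} \<and> card T = 2 \<longrightarrow> card {J \<in> \<B>. T \<subseteq> J} = l) \<and>
     (\<forall>p\<in>{1..n}. card {J \<in> \<B>. p \<in> J} = r)"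

lemma replication_number_exists:
  fixes \<B> :: "nat set set"
  assumes k: "2 \<le> k"
    and blocks: "\<forall>J\<in>\<B>. J \<subseteq> {1..n} \<and> card J = k"
    and pairs: "\<forall>T. T \<subseteq> {1..n} \<and> card T = 2 \<longrightarrow> card {J \<in> \<B>. T \<subseteq> J} = l"
  shows "\<exists>r. \<forall>p\<in>{1..n}. card {J \<in> \<B>. p \<in> J} = r"
proof -
  have "\<B> \<subseteq> Pow {1..n}"
    using blocks by blast
  then have fin: "finite \<B>"
    by (rule finite_subset) simp
  have "card {J \<in> \<B>. p \<in> J} = (n - 1) * l div (k - 1)" if p: "p \<in> {1..n}" for p
  proof -
    let ?P = "{1..n} - {p}" and ?Bp = "{J \<in> \<B>. p \<in> J}"
    have "(\<Sum>q\<in>?P. card {J \<in> ?Bp. q \<in> J}) = (\<Sum>J\<in>?Bp. card {q \<in> ?P. q \<in> J})"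
      using fin by (intro sum_multicount_gen) auto
    moreover have "card {J \<in> ?Bp. q \<in> J} = l" if "q \<in> ?P" for q
    proof -
      have "{J \<in> ?Bp. q \<in> J} = {J \<in> \<B>. {p, q} \<subseteq> J}"
        by auto
      then show ?thesis
        using pairs[rule_format, of "{p, q}"] p that by auto
    qed
    moreover have "card {q \<in> ?P. q \<in> J} = k - 1" if "J \<in> ?Bp" for J
    proof -
      have "J \<subseteq> {1..n}"
        using blocks that by blast
      then have "{q \<in> ?P. q \<in> J} = J - {p}"
        by blast
      then show ?thesis
        using blocks that by simp
    qed
    ultimately have "card ?P * l = card ?Bp * (k - 1)"
      by simp
    moreover have "card ?P = n - 1"
      using p by simp
    ultimately show ?thesis
      using k by simp
  qed
  then show ?thesis
    by blast
qed

definition quasi_symmetric :: "nat set set \<Rightarrow> nat \<Rightarrow> nat \<Rightarrow> bool" where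
  "quasi_symmetric \<B> x y \<longleftrightarrow>
     x < y \<and> {card (I \<inter> J) |I J. I \<in> \<B> \<and> J \<in> \<B> \<and> I \<noteq> J} = {x, y}"

section \<open>Families of vectors\<close>

text \<open>
  A family is given by its index set and a function on indices; an angle is the value of an
  inner product.
\<close>

definition two_distance_set :: "'i set \<Rightarrow> ('i \<Rightarrow> 'a::real_inner) \<Rightarrow> real \<Rightarrow> real \<Rightarrow> bool" where
  "two_distance_set I f \<alpha> \<beta> \<longleftrightarrow>
     finite I \<and> \<alpha> \<noteq> \<beta> \<and> (\<forall>i\<in>I. norm (f i) = 1) \<and>
     {f i \<bullet> f j |i j. i \<in> I \<and> j \<in> I \<and> i \<noteq> j} = {\<alpha>, \<beta>}"

text \<open>Multiplicities are real so that they can be compared with quotients.\<close>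

definition has_multiplicity :: "'i set \<Rightarrow> ('i \<Rightarrow> 'a::real_inner) \<Rightarrow> real \<Rightarrow> real \<Rightarrow> bool" where
  "has_multiplicity I f \<alpha> m \<longleftrightarrow> (\<forall>i\<in>I. real (card {j \<in> I. j \<noteq> i \<and> f i \<bullet> f j = \<alpha>}) = m)"

definition regular_two_distance_set ::
    "'i set \<Rightarrow> ('i \<Rightarrow> 'a::real_inner) \<Rightarrow> real \<Rightarrow> real \<Rightarrow> bool" where
  "regular_two_distance_set I f \<alpha> \<beta> \<longleftrightarrow>
     two_distance_set I f \<alpha> \<beta> \<and>
     (\<exists>m. has_multiplicity I f \<alpha> m) \<and> (\<exists>m. has_multiplicity I f \<beta> m)"

definition two_distance_frame ::
    "'i set \<Rightarrow> ('i \<Rightarrow> 'a::euclidean_space) \<Rightarrow> real \<Rightarrow> real \<Rightarrow> bool" where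
  "two_distance_frame I f \<alpha> \<beta> \<longleftrightarrow> two_distance_set I f \<alpha> \<beta> \<and> span (f ` I) = UNIV"

definition tight :: "'i set \<Rightarrow> ('i \<Rightarrow> 'a::euclidean_space) \<Rightarrow> bool" where
  "tight I f \<longleftrightarrow> (\<exists>A>0. \<forall>v. (\<Sum>i\<in>I. (v \<bullet> f i) *\<^sub>R f i) = A *\<^sub>R v)"

definition balanced :: "'i set \<Rightarrow> ('i \<Rightarrow> 'a::real_vector) \<Rightarrow> bool" where
  "balanced I f \<longleftrightarrow> (\<Sum>i\<in>I. f i) = 0"

text \<open>The ambient space, of dimension n - 1, is the type \<open>'a\<close>.\<close>

definition simplex_family :: "nat \<Rightarrow> (nat \<Rightarrow> 'a::euclidean_space) \<Rightarrow> bool" where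
  "simplex_family n \<phi> \<longleftrightarrow>
     n = DIM('a) + 1 \<and>
     (\<forall>i\<in>{1..n}. norm (\<phi> i) = 1) \<and>
     (\<forall>i\<in>{1..n}. \<forall>j\<in>{1..n}. i \<noteq> j \<longrightarrow> \<phi> i \<bullet> \<phi> j = - 1 / (real n - 1))"

end

theory Submission
  imports Defs
begin

text \<open>
  Both families consist of scaled block sums of vectors \<open>f 1, \<dots>, f n\<close> with constant off-diagonal
  inner product \<open>c\<close>, so the inner product of two block sums is an increasing affine function of the
  size of the intersection of the blocks; counting incidences gives the multiplicities. The frame
  operator of the block sums is \<open>(r - \<lambda>) T + \<lambda> \<langle>\<cdot>, S\<rangle> S\<close>, where \<open>T\<close> is the frame operator of \<open>f\<close>
  and \<open>S = f 1 + \<dots> + f n\<close>. Since \<open>T\<close> is a positive multiple of the identity and \<open>\<lambda> < r\<close>, the block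
  sums span. For a simplex \<open>S = 0\<close>, so they form a tight frame; for an orthonormal basis \<open>S\<close> and
  \<open>e 1 - e 2\<close> are eigenvectors with different eigenvalues.
\<close>

section \<open>Counting in designs\<close>

lemma two_design_finite:
  assumes "two_design n \<B> b r k l"
  shows "finite \<B>"
proof -
  have "\<B> \<subseteq> Pow {1..n}"
    using assms by (auto simp: two_design_def)
  then show ?thesis
    by (rule finite_subset) simp
qed

lemma two_design_pair_card:
  assumes "two_design n \<B> b r k l" "p \<in> {1..n}" "q \<in> {1..n}" "p \<noteq> q"
  shows "card {J \<in> \<B>. p \<in> J \<and> q \<in> J} = l"
proof -
  have "{p, q} \<subseteq> {1..n}" "card {p, q} = 2"
    using assms by auto
  then have "card {J \<in> \<B>. {p, q} \<subseteq> J} = l"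
    using assms(1) unfolding two_design_def by blast
  then show ?thesis
    by simp
qed

text \<open>Count the pairs (\<open>q\<close>, \<open>J\<close>) with \<open>q\<close> distinct from
  the point 1 and both points in \<open>J\<close>: each \<open>q\<close> contributes
  \<open>l\<close>, each block through 1 contributes \<open>k - 1\<close>.\<close>

lemma two_design_replication:
  assumes D: "two_design n \<B> b r k l"
  shows "r * (k - 1) = l * (n - 1)"
proof -
  have n: "1 \<in> {1..n}"
    using D by (auto simp: two_design_def)
  let ?P = "{1..n} - {1}" and ?Bp = "{J \<in> \<B>. 1 \<in> J}"
  have "(\<Sum>q\<in>?P. card {J \<in> ?Bp. q \<in> J}) = (\<Sum>J\<in>?Bp. card {q \<in> ?P. q \<in> J})"
    using two_design_finite[OF D] by (intro sum_multicount_gen) auto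
  moreover have "card {J \<in> ?Bp. q \<in> J} = l" if "q \<in> ?P" for q
    using two_design_pair_card[OF D n, of q] that by (simp add: conj_assoc)
  moreover have "card {q \<in> ?P. q \<in> J} = k - 1" if "J \<in> ?Bp" for J
  proof -
    have J: "J \<subseteq> {1..n}" "card J = k"
      using D that by (auto simp: two_design_def)
    then have "{q \<in> ?P. q \<in> J} = J - {1}"
      by blast
    then show ?thesis
      using J that by simp
  qed
  moreover have "card ?Bp = r"
    using D n by (auto simp: two_design_def)
  ultimately show ?thesis
    using n by (simp add: mult.commute)
qed

text \<open>By the replication identity, \<open>k < n\<close> gives
  \<open>l * (k - 1) < r * (k - 1)\<close>. The strictness makes the coefficient
  \<open>r - l\<close> in the frame operator positive.\<close>

lemma two_design_less_replication:
  assumes D: "two_design n \<B> b r k l"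
  shows "l < r"
proof -
  have k: "2 \<le> k" "k < n" "1 \<le> l"
    using D by (auto simp: two_design_def)
  then have "l * (k - 1) < l * (n - 1)"
    by (intro mult_strict_left_mono) auto
  then show ?thesis
    using two_design_replication[OF D] by (metis mult_less_cancel2)
qed

text \<open>Count incidences between the points of \<open>J\<close> and all blocks: each of the
  \<open>k\<close> points lies in \<open>r\<close> blocks. The block \<open>J\<close> itself is
  included.\<close>

lemma two_design_sum_card_inter:
  assumes D: "two_design n \<B> b r k l" and J: "J \<in> \<B>"
  shows "(\<Sum>I\<in>\<B>. card (J \<inter> I)) = k * r"
proof -
  have sub: "J \<subseteq> {1..n}" and k: "card J = k"
    using D J by (auto simp: two_design_def)
  have "(\<Sum>p\<in>J. card {I \<in> \<B>. p \<in> I}) = (\<Sum>I\<in>\<B>. card {p \<in> J. p \<in> I})"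
    using two_design_finite[OF D] sub finite_subset by (intro sum_multicount_gen) auto
  moreover have "(\<Sum>p\<in>J. card {I \<in> \<B>. p \<in> I}) = (\<Sum>p\<in>J. r)"
    using D sub by (intro sum.cong) (auto simp: two_design_def)
  moreover have "{p \<in> J. p \<in> I} = J \<inter> I" for I
    by blast
  ultimately show ?thesis
    using k by simp
qed

text \<open>The two cardinalities solve a linear system: their sum is \<open>b - 1\<close>, and
  weighted by \<open>x\<close> and \<open>y\<close> they add up to \<open>k * (r - 1)\<close>. As
  \<open>x < y\<close>, the solution is unique and does not depend on \<open>J\<close>.\<close>

lemma quasi_symmetric_counts:
  fixes s :: real
  assumes D: "two_design n \<B> b r k l" and Q: "quasi_symmetric \<B> x y"
    and s: "s = (real k * (real r - 1) - real x * (real b - 1)) / (real y - real x)"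
    and J: "J \<in> \<B>"
  shows "real (card {I \<in> \<B>. I \<noteq> J \<and> card (J \<inter> I) = x}) = real b - s - 1"
    and "real (card {I \<in> \<B>. I \<noteq> J \<and> card (J \<inter> I) = y}) = s"
proof -
  let ?X = "{I \<in> \<B>. I \<noteq> J \<and> card (J \<inter> I) = x}" and ?Y = "{I \<in> \<B>. I \<noteq> J \<and> card (J \<inter> I) = y}"
  have fin: "finite \<B>" and xy: "x < y" and k: "card J = k" and b: "card \<B> = b"
    using two_design_finite[OF D] D Q J by (auto simp: two_design_def quasi_symmetric_def)
  have "card (J \<inter> I) = x \<or> card (J \<inter> I) = y" if "I \<in> \<B>" "I \<noteq> J" for I
  proof -
    have "card (J \<inter> I) \<in> {card (I \<inter> J) |I J. I \<in> \<B> \<and> J \<in> \<B> \<and> I \<noteq> J}"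
      using J that by blast
    then show ?thesis
      using Q unfolding quasi_symmetric_def by (metis insert_iff empty_iff)
  qed
  then have un: "\<B> - {J} = ?X \<union> ?Y"
    by blast
  have dj: "?X \<inter> ?Y = {}"
    using xy by auto
  have "card \<B> = Suc (card (\<B> - {J}))"
    by (rule card.remove[OF fin J])
  also have "card (\<B> - {J}) = card ?X + card ?Y"
    unfolding un using fin dj by (intro card_Un_disjoint) auto
  finally have total: "real b = 1 + real (card ?X) + real (card ?Y)"
    using b by simp
  \<comment> \<open>The term of \<open>J\<close> itself is split off; it contributes
    \<open>k\<close> and accounts for the \<open>r - 1\<close> in the formula for
    \<open>s\<close>.\<close>
  have "k * r = card (J \<inter> J) + (\<Sum>I\<in>\<B> - {J}. card (J \<inter> I))"
    using two_design_sum_card_inter[OF D J] sum.remove[OF fin J, of "\<lambda>I. card (J \<inter> I)"] by simp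
  also have "(\<Sum>I\<in>\<B> - {J}. card (J \<inter> I)) = (\<Sum>I\<in>?X. card (J \<inter> I)) + (\<Sum>I\<in>?Y. card (J \<inter> I))"
    unfolding un using fin dj by (intro sum.union_disjoint) auto
  also have "\<dots> = card ?X * x + card ?Y * y"
    by simp
  finally have "k * r = k + (card ?X * x + card ?Y * y)"
    using k by simp
  from arg_cong[OF this, of real]
  have "real k * real r = real k + (real (card ?X) * real x + real (card ?Y) * real y)"
    unfolding of_nat_add of_nat_mult .
  then have "real k * (real r - 1) - real x * (real b - 1) = real (card ?Y) * (real y - real x)"
    using total by (simp add: algebra_simps)
  then show Y: "real (card ?Y) = s"
    using s xy by simp
  show "real (card ?X) = real b - s - 1"
    using Y total by simp
qed

section \<open>Block sums of equiangular families\<close>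

text \<open>The Gram matrix is \<open>1 - c\<close> times the identity plus \<open>c\<close> times
  the all-ones matrix. The first part counts common indices, the second all pairs.\<close>

lemma inner_sum_equiangular:
  fixes f :: "'i \<Rightarrow> 'a::real_inner"
  assumes gram: "\<And>i j. i \<in> A \<Longrightarrow> j \<in> A \<Longrightarrow> f i \<bullet> f j = (if i = j then 1 else c)"
    and fin: "finite A" and sub: "I \<subseteq> A" "J \<subseteq> A"
  shows "(\<Sum>i\<in>I. f i) \<bullet> (\<Sum>j\<in>J. f j) = (1 - c) * card (I \<inter> J) + c * (card I * card J)"
proof -
  have fI: "finite I" "finite J"
    using fin sub finite_subset by auto
  have "(\<Sum>i\<in>I. f i) \<bullet> (\<Sum>j\<in>J. f j) = (\<Sum>i\<in>I. \<Sum>j\<in>J. (if i = j then 1 - c else 0) + c)"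
    by (subst inner_sum_left, intro sum.cong refl, subst inner_sum_right, intro sum.cong refl)
      (simp add: gram subsetD[OF sub(1)] subsetD[OF sub(2)])
  also have "\<dots> = (\<Sum>i\<in>I. (if i \<in> J then 1 - c else 0)) + c * (card I * card J)"
    using fI by (simp add: sum.distrib)
  also have "(\<Sum>i\<in>I. (if i \<in> J then 1 - c else 0)) = (1 - c) * card (I \<inter> J)"
    using fI by (simp flip: sum.inter_restrict)
  finally show ?thesis .
qed

text \<open>The inner product of two block vectors is \<open>g (card (I \<inter> J))\<close> for an
  affine \<open>g\<close>, injective because \<open>c < 1\<close>. The hypothesis on
  \<open>t\<close> says \<open>g k = 1\<close>, which gives unit norm; the angles are
  \<open>g x\<close> and \<open>g y\<close>.\<close>

lemma block_sums_two_distance: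
  fixes f :: "nat \<Rightarrow> 'a::real_inner" and s c t :: real
  defines "X \<equiv> \<lambda>J. t *\<^sub>R (\<Sum>i\<in>J. f i)"
  assumes D: "two_design n \<B> b r k l" and Q: "quasi_symmetric \<B> x y"
    and s: "s = (real k * (real r - 1) - real x * (real b - 1)) / (real y - real x)"
    and gram: "\<And>i j. i \<in> {1..n} \<Longrightarrow> j \<in> {1..n} \<Longrightarrow> f i \<bullet> f j = (if i = j then 1 else c)"
    and c: "c < 1"
    and t: "t\<^sup>2 * ((1 - c) * k + c * (real k)\<^sup>2) = 1"
    and \<alpha>: "\<alpha> = t\<^sup>2 * ((1 - c) * x + c * (real k)\<^sup>2)"
    and \<beta>: "\<beta> = t\<^sup>2 * ((1 - c) * y + c * (real k)\<^sup>2)"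
  shows "two_distance_set \<B> X \<alpha> \<beta>"
    and "has_multiplicity \<B> X \<alpha> (real b - s - 1)"
    and "has_multiplicity \<B> X \<beta> s"
proof -
  define g where "g m = t\<^sup>2 * ((1 - c) * real m + c * (real k)\<^sup>2)" for m :: nat
  have block: "J \<subseteq> {1..n}" "card J = k" if "J \<in> \<B>" for J
    using D that by (auto simp: two_design_def)
  have "t \<noteq> 0"
    using t by auto
  then have g_inj: "g m = g m' \<longleftrightarrow> m = m'" for m m'
    using c by (auto simp: g_def)
  have inner: "X I \<bullet> X J = g (card (I \<inter> J))" if "I \<in> \<B>" "J \<in> \<B>" for I J
    using inner_sum_equiangular[of "{1..n}" f c I J, OF gram] block[OF that(1)] block[OF that(2)]
    by (simp add: X_def g_def power2_eq_square)
  have unit: "norm (X J) = 1" if "J \<in> \<B>" for J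
    using inner[OF that that] block[OF that] t by (simp add: norm_eq_sqrt_inner g_def)
  have ab: "\<alpha> = g x" "\<beta> = g y"
    using \<alpha> \<beta> by (simp_all add: g_def)
  have "{X I \<bullet> X J |I J. I \<in> \<B> \<and> J \<in> \<B> \<and> I \<noteq> J}
      = g ` {card (I \<inter> J) |I J. I \<in> \<B> \<and> J \<in> \<B> \<and> I \<noteq> J}"
    using inner by (auto simp: image_iff) metis+
  also have "\<dots> = {\<alpha>, \<beta>}"
    using Q ab by (simp add: quasi_symmetric_def)
  finally have angles: "{X I \<bullet> X J |I J. I \<in> \<B> \<and> J \<in> \<B> \<and> I \<noteq> J} = {\<alpha>, \<beta>}" .
  have "x < y"
    using Q by (simp add: quasi_symmetric_def)
  then show "two_distance_set \<B> X \<alpha> \<beta>"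
    using angles unit two_design_finite[OF D] ab g_inj by (simp add: two_distance_set_def)
  \<comment> \<open>Injectivity of \<open>g\<close> turns a condition on the angle into one on the
    size of the intersection, which has been counted.\<close>
  have same: "{I \<in> \<B>. I \<noteq> J \<and> X J \<bullet> X I = g m} = {I \<in> \<B>. I \<noteq> J \<and> card (J \<inter> I) = m}"
    if "J \<in> \<B>" for J m
    using inner[OF that] g_inj by auto
  show "has_multiplicity \<B> X \<alpha> (real b - s - 1)" "has_multiplicity \<B> X \<beta> s"
    using quasi_symmetric_counts[OF D Q s] by (simp_all add: has_multiplicity_def ab same)
qed

text \<open>Expanding both block sums, the coefficient of the pair \<open>i\<close>,
  \<open>j\<close> is the number of blocks containing both points: \<open>r\<close> on the diagonal
  and \<open>l\<close> elsewhere. The excess \<open>r - l\<close> on the diagonal yields the frame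
  operator of \<open>f\<close>, the constant \<open>l\<close> a rank-one term.\<close>

lemma block_sums_frame_operator:
  fixes f :: "nat \<Rightarrow> 'a::real_inner" and v :: 'a
  assumes D: "two_design n \<B> b r k l"
  shows "(\<Sum>J\<in>\<B>. (v \<bullet> (t *\<^sub>R (\<Sum>i\<in>J. f i))) *\<^sub>R (t *\<^sub>R (\<Sum>i\<in>J. f i)))
    = t\<^sup>2 *\<^sub>R ((real r - real l) *\<^sub>R (\<Sum>i=1..n. (v \<bullet> f i) *\<^sub>R f i)
        + (real l * (v \<bullet> (\<Sum>i=1..n. f i))) *\<^sub>R (\<Sum>i=1..n. f i))"
proof -
  let ?N = "{1..n}"
  have fin: "finite \<B>"
    by (rule two_design_finite[OF D])
  \<comment> \<open>Indicator weights make the range of summation independent of the block, so that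
    the sums can be interchanged.\<close>
  have restrict: "(\<Sum>i\<in>J. h i) = (\<Sum>i\<in>?N. of_bool (i \<in> J) *\<^sub>R h i)"
    if "J \<in> \<B>" for J and h :: "nat \<Rightarrow> 'c::real_vector"
  proof -
    have "J \<subseteq> ?N"
      using D that by (auto simp: two_design_def)
    then show ?thesis
      by (intro sum.mono_neutral_cong_left) auto
  qed
  have count: "(\<Sum>J\<in>\<B>. of_bool (i \<in> J) * of_bool (j \<in> J))
      = (if i = j then real r - real l else 0) + real l"
    if "i \<in> ?N" "j \<in> ?N" for i j
  proof -
    have "(\<Sum>J\<in>\<B>. of_bool (i \<in> J) * of_bool (j \<in> J)) = (\<Sum>J\<in>\<B>. of_bool (i \<in> J \<and> j \<in> J) :: real)"
      by (intro sum.cong) auto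
    also have "\<dots> = real (card {J \<in> \<B>. i \<in> J \<and> j \<in> J})"
      using fin by (simp add: sum_of_bool_eq Int_def)
    also have "\<dots> = (if i = j then real r - real l else 0) + real l"
      using D that two_design_pair_card[OF D that] by (auto simp: two_design_def)
    finally show ?thesis .
  qed
  have "(\<Sum>J\<in>\<B>. (v \<bullet> (\<Sum>i\<in>J. f i)) *\<^sub>R (\<Sum>i\<in>J. f i))
      = (\<Sum>J\<in>\<B>. \<Sum>i\<in>?N. \<Sum>j\<in>?N. (of_bool (i \<in> J) * of_bool (j \<in> J) * (v \<bullet> f i)) *\<^sub>R f j)"
    by (intro sum.cong refl)
      (simp only: restrict inner_sum_right inner_scaleR_right scaleR_sum_left,
        simp only: scaleR_sum_right scaleR_scaleR mult_ac)
  also have "\<dots> = (\<Sum>i\<in>?N. \<Sum>j\<in>?N. \<Sum>J\<in>\<B>. (of_bool (i \<in> J) * of_bool (j \<in> J) * (v \<bullet> f i)) *\<^sub>R f j)"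
    by (subst sum.swap, rule sum.cong[OF refl], rule sum.swap)
  also have "\<dots> = (\<Sum>i\<in>?N. \<Sum>j\<in>?N. (((if i = j then real r - real l else 0) + real l) * (v \<bullet> f i)) *\<^sub>R f j)"
    by (intro sum.cong refl) (simp flip: scaleR_sum_left sum_distrib_right add: count)
  also have "\<dots> = (\<Sum>i\<in>?N. \<Sum>j\<in>?N. (if i = j then ((real r - real l) * (v \<bullet> f i)) *\<^sub>R f j else 0)
      + (real l * (v \<bullet> f i)) *\<^sub>R f j)"
    by (intro sum.cong refl) (auto simp: algebra_simps)
  also have "\<dots> = (real r - real l) *\<^sub>R (\<Sum>i\<in>?N. (v \<bullet> f i) *\<^sub>R f i)
      + (real l * (v \<bullet> (\<Sum>i\<in>?N. f i))) *\<^sub>R (\<Sum>i\<in>?N. f i)"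
    by (simp add: sum.distrib inner_sum_right sum_distrib_left
        scaleR_sum_left flip: scaleR_sum_right)
       (simp add: scaleR_sum_right)
  finally have *: "(\<Sum>J\<in>\<B>. (v \<bullet> (\<Sum>i\<in>J. f i)) *\<^sub>R (\<Sum>i\<in>J. f i)) = \<dots>" .
  have "(\<Sum>J\<in>\<B>. (v \<bullet> (t *\<^sub>R (\<Sum>i\<in>J. f i))) *\<^sub>R (t *\<^sub>R (\<Sum>i\<in>J. f i)))
      = t\<^sup>2 *\<^sub>R (\<Sum>J\<in>\<B>. (v \<bullet> (\<Sum>i\<in>J. f i)) *\<^sub>R (\<Sum>i\<in>J. f i))"
    unfolding scaleR_sum_right[of _ _ \<B>]
    by (simp add: power2_eq_square mult_ac)
  then show ?thesis
    unfolding * .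
qed

text \<open>A proper span has a nonzero \<open>v\<close> orthogonal to it, and the frame operator
  vanishes at \<open>v\<close>. Pairing with \<open>v\<close> gives a positive multiple of
  \<open>v \<bullet> v\<close> plus a nonnegative square, a contradiction.\<close>

lemma block_sums_span:
  fixes f :: "nat \<Rightarrow> 'a::euclidean_space" and t a :: real
  defines "X \<equiv> \<lambda>J. t *\<^sub>R (\<Sum>i\<in>J. f i)"
  assumes D: "two_design n \<B> b r k l" and "t \<noteq> 0" and "0 < a"
    and T: "\<And>v. (\<Sum>i=1..n. (v \<bullet> f i) *\<^sub>R f i) = a *\<^sub>R v"
  shows "span (X ` \<B>) = UNIV"
proof (rule ccontr)
  assume "span (X ` \<B>) \<noteq> UNIV"
  then obtain v where v: "v \<noteq> 0" and orth: "\<forall>w\<in>span (X ` \<B>). v \<bullet> w = 0"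
    using span_not_univ_subset_hyperplane by (metis (mono_tags, lifting) mem_Collect_eq subsetD)
  let ?S = "\<Sum>i=1..n. f i"
  have "(\<Sum>J\<in>\<B>. (v \<bullet> X J) *\<^sub>R X J) = 0"
    using orth by (intro sum.neutral) (simp add: span_base)
  then have "t\<^sup>2 *\<^sub>R ((real r - real l) *\<^sub>R a *\<^sub>R v + (real l * (v \<bullet> ?S)) *\<^sub>R ?S) = 0"
    unfolding X_def block_sums_frame_operator[OF D] T .
  then have "v \<bullet> ((real r - real l) *\<^sub>R a *\<^sub>R v + (real l * (v \<bullet> ?S)) *\<^sub>R ?S) = 0"
    using \<open>t \<noteq> 0\<close> by simp
  then have "(real r - real l) * a * (v \<bullet> v) + real l * (v \<bullet> ?S)\<^sup>2 = 0"
    by (simp add: inner_add_right power2_eq_square)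
  moreover have "0 < (real r - real l) * a * (v \<bullet> v)"
    using two_design_less_replication[OF D] \<open>0 < a\<close> v by simp
  moreover have "0 \<le> real l * (v \<bullet> ?S)\<^sup>2"
    by simp
  ultimately show False
    by linarith
qed

section \<open>Simplices\<close>

lemma simplex_gram:
  assumes "simplex_family n \<phi>" "i \<in> {1..n}" "j \<in> {1..n}"
  shows "\<phi> i \<bullet> \<phi> j = (if i = j then 1 else - 1 / (real n - 1))"
  using assms by (simp add: simplex_family_def norm_eq_1)

text \<open>The squared norm of the sum is \<open>n * (1 + (n - 1) * c)\<close> with
  \<open>c = - 1 / (n - 1)\<close>, hence zero.\<close>

lemma simplex_sum_zero:
  assumes S: "simplex_family n \<phi>" and n: "2 \<le> n"
  shows "(\<Sum>i=1..n. \<phi> i) = 0"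
proof -
  have "(\<Sum>i=1..n. \<phi> i) \<bullet> (\<Sum>i=1..n. \<phi> i) = 0"
    using inner_sum_equiangular[of "{1..n}" \<phi>, OF simplex_gram[OF S]] n
    by (simp add: field_simps)
  then show ?thesis
    by simp
qed

text \<open>The first \<open>n - 1\<close> vectors are independent, and their number is the
  dimension. The last one is left out because all \<open>n\<close> together sum to zero.\<close>

lemma simplex_span:
  fixes \<phi> :: "nat \<Rightarrow> 'a::euclidean_space"
  assumes S: "simplex_family n \<phi>" and n: "2 \<le> n"
  shows "span (\<phi> ` {1..n}) = UNIV"
proof -
  let ?M = "{1..<n}"
  have gram: "\<phi> i \<bullet> \<phi> j = (if i = j then real n / (real n - 1) else 0) - 1 / (real n - 1)"
    if "i \<in> ?M" "j \<in> ?M" for i j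
    using simplex_gram[OF S, of i j] that n by (auto simp: field_simps)
  have zero: "a j = 0" if rel: "(\<Sum>i\<in>?M. a i *\<^sub>R \<phi> i) = 0" and j: "j \<in> ?M" for a j
  proof -
    \<comment> \<open>The inner product of the relation with \<open>\<phi> j\<close> shows that all
      coefficients equal one \<open>n\<close>-th of their sum.\<close>
    have *: "real n * a j = (\<Sum>i\<in>?M. a i)" if "j \<in> ?M" for j
    proof -
      have "0 = (\<Sum>i\<in>?M. a i *\<^sub>R \<phi> i) \<bullet> \<phi> j"
        using rel by simp
      also have "\<dots> = (\<Sum>i\<in>?M. (if i = j then a i * (real n / (real n - 1)) else 0) - a i / (real n - 1))"
        using that by (auto simp: inner_sum_left gram algebra_simps intro!: sum.cong)
      also have "\<dots> = a j * (real n / (real n - 1)) - (\<Sum>i\<in>?M. a i) / (real n - 1)"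
        using that by (simp add: sum_subtractf sum_divide_distrib)
      also have "\<dots> = (real n * a j - (\<Sum>i\<in>?M. a i)) / (real n - 1)"
        by (simp add: diff_divide_distrib mult.commute)
      finally show ?thesis
        using n by simp
    qed
    \<comment> \<open>Adding these equations over only \<open>n - 1\<close> indices forces the sum
      of the coefficients to vanish.\<close>
    have "real n * (\<Sum>i\<in>?M. a i) = (real n - 1) * (\<Sum>i\<in>?M. a i)"
      using n by (simp add: sum_distrib_left * of_nat_diff)
    then have "(\<Sum>i\<in>?M. a i) = 0"
      by (simp add: algebra_simps)
    then show ?thesis
      using *[OF j] n by simp
  qed
  \<comment> \<open>Independence concerns the set of vectors, so indices and vectors must
    correspond: equal vectors would have inner product 1, not a negative one.\<close>
  have inj: "inj_on \<phi> ?M"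
  proof
    fix i j assume ij: "i \<in> ?M" "j \<in> ?M" "\<phi> i = \<phi> j"
    show "i = j"
    proof (rule ccontr)
      assume "i \<noteq> j"
      then have "- 1 / (real n - 1) = \<phi> i \<bullet> \<phi> j"
        using simplex_gram[OF S, of i j] ij by simp
      also have "\<dots> = 1"
        using simplex_gram[OF S, of i i] ij by simp
      finally show False
        using n by (simp add: field_simps)
    qed
  qed
  have "independent (\<phi> ` ?M)"
    unfolding independent_explicit_finite_subsets
  proof (intro allI impI ballI)
    fix A u v
    assume A: "A \<subseteq> \<phi> ` ?M" "finite A" and sum: "(\<Sum>v\<in>A. u v *\<^sub>R v) = 0" and v: "v \<in> A"
    \<comment> \<open>A relation on the subset \<open>A\<close> is extended by zero coefficients to
      all indices in \<open>?M\<close>.\<close>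
    have "(\<Sum>i\<in>?M. (if \<phi> i \<in> A then u (\<phi> i) else 0) *\<^sub>R \<phi> i)
        = (\<Sum>w\<in>\<phi> ` ?M. (if w \<in> A then u w else 0) *\<^sub>R w)"
      using inj by (simp add: sum.reindex)
    also have "\<dots> = (\<Sum>w\<in>A. u w *\<^sub>R w)"
      using A by (intro sum.mono_neutral_cong_right) auto
    finally have "(\<Sum>i\<in>?M. (if \<phi> i \<in> A then u (\<phi> i) else 0) *\<^sub>R \<phi> i) = 0"
      using sum by simp
    from zero[OF this] show "u v = 0"
      using A v by (force split: if_splits)
  qed
  moreover have "card (\<phi> ` ?M) = DIM('a)"
    using inj S by (simp add: card_image simplex_family_def)
  ultimately have "UNIV \<subseteq> span (\<phi> ` ?M)"
    by (intro card_ge_dim_independent) auto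
  also have "\<dots> \<subseteq> span (\<phi> ` {1..n})"
    by (intro span_mono image_mono) auto
  finally show ?thesis
    by blast
qed

text \<open>Both sides are linear in \<open>v\<close>, so the spanning vectors
  \<open>\<phi> j\<close> suffice. There the Gram matrix gives the claimed multiple of
  \<open>\<phi> j\<close> minus a multiple of the sum of all \<open>\<phi> i\<close>, which is
  zero.\<close>

lemma simplex_frame_operator:
  fixes \<phi> :: "nat \<Rightarrow> 'a::euclidean_space"
  assumes S: "simplex_family n \<phi>" and n: "2 \<le> n"
  shows "(\<Sum>i=1..n. (v \<bullet> \<phi> i) *\<^sub>R \<phi> i) = (real n / (real n - 1)) *\<^sub>R v"
proof -
  let ?T = "\<lambda>v. \<Sum>i=1..n. (v \<bullet> \<phi> i) *\<^sub>R \<phi> i"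
  have "linear ?T"
    by (intro linear_compose_sum ballI linearI) (auto simp: inner_add_left scaleR_add_left)
  moreover have "linear (\<lambda>v :: 'a. (real n / (real n - 1)) *\<^sub>R v)"
    by simp
  moreover have "?T w = (real n / (real n - 1)) *\<^sub>R w" if w: "w \<in> \<phi> ` {1..n}" for w
  proof -
    obtain j where j: "j \<in> {1..n}" "w = \<phi> j"
      using w by blast
    have "?T w = (\<Sum>i=1..n. (if j = i then (real n / (real n - 1)) *\<^sub>R \<phi> i else 0)
        - (1 / (real n - 1)) *\<^sub>R \<phi> i)"
    proof (rule sum.cong[OF refl])
      fix i assume i: "i \<in> {1..n}"
      have "w \<bullet> \<phi> i = (if j = i then real n / (real n - 1) else 0) - 1 / (real n - 1)"
        using simplex_gram[OF S j(1) i] j(2) n by (auto simp: field_simps)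
      then show "(w \<bullet> \<phi> i) *\<^sub>R \<phi> i = (if j = i then (real n / (real n - 1)) *\<^sub>R \<phi> i else 0)
        - (1 / (real n - 1)) *\<^sub>R \<phi> i"
        by (simp add: scaleR_left_diff_distrib)
    qed
    also have "\<dots> = (real n / (real n - 1)) *\<^sub>R w"
      using j simplex_sum_zero[OF S n] by (simp add: sum_subtractf flip: scaleR_sum_right)
    finally show ?thesis .
  qed
  moreover have "v \<in> span (\<phi> ` {1..n})"
    unfolding simplex_span[OF S n] by (rule UNIV_I)
  ultimately show ?thesis
    by (rule linear_eq_on_span)
qed

section \<open>The two frames of a quasi-symmetric design\<close>

text \<open>This is the case \<open>c = 0\<close> with squared scale \<open>1 / k\<close>; the frame
  operator of the basis is the identity. Tightness would force the same eigenvalue on two vectors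
  where the eigenvalues differ.\<close>

lemma block_sums_orthonormal:
  fixes e :: "nat \<Rightarrow> 'a::euclidean_space" and s :: real and k :: nat
  defines "X \<equiv> \<lambda>J. (1 / sqrt (real k)) *\<^sub>R (\<Sum>i\<in>J. e i)"
  assumes D: "two_design n \<B> b r k l" and Q: "quasi_symmetric \<B> x y"
    and s: "s = (real k * (real r - 1) - real x * (real b - 1)) / (real y - real x)"
    and e: "bij_betw e {1..n} Basis"
  shows "two_distance_frame \<B> X (real x / real k) (real y / real k)"
    and "has_multiplicity \<B> X (real x / real k) (real b - s - 1)"
    and "has_multiplicity \<B> X (real y / real k) s"
    and "\<not> tight \<B> X"
proof -
  let ?t = "1 / sqrt (real k)" and ?S = "\<Sum>i=1..n. e i"
  have k: "2 \<le> k" "k < n" "1 \<le> l"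
    using D by (auto simp: two_design_def)
  have t: "?t\<^sup>2 = 1 / real k" "?t \<noteq> 0"
    using k by (simp_all add: power_divide)
  have gram: "e i \<bullet> e j = (if i = j then 1 else 0)" if "i \<in> {1..n}" "j \<in> {1..n}" for i j
  proof -
    have "e i \<in> Basis" "e j \<in> Basis" "e i = e j \<longleftrightarrow> i = j"
      using e that by (auto simp: bij_betw_def inj_on_eq_iff simp del: atLeastAtMost_iff)
    then show ?thesis
      by (simp add: inner_Basis)
  qed
  have T: "(\<Sum>i=1..n. (v \<bullet> e i) *\<^sub>R e i) = 1 *\<^sub>R v" for v
    using sum.reindex_bij_betw[OF e, of "\<lambda>w. (v \<bullet> w) *\<^sub>R w"] by (simp add: euclidean_representation)
  note two = block_sums_two_distance[OF D Q s gram, where t = ?t and \<alpha> = "real x / real k"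
      and \<beta> = "real y / real k", folded X_def]
  have "span (X ` \<B>) = UNIV"
    unfolding X_def by (rule block_sums_span[OF D t(2) _ T]) simp
  then show "two_distance_frame \<B> X (real x / real k) (real y / real k)"
    using two(1) t k by (simp add: two_distance_frame_def)
  show "has_multiplicity \<B> X (real x / real k) (real b - s - 1)"
      "has_multiplicity \<B> X (real y / real k) s"
    using two(2,3) t k by simp_all
  show "\<not> tight \<B> X"
  proof
    assume "tight \<B> X"
    then obtain A where A: "\<And>v. (\<Sum>J\<in>\<B>. (v \<bullet> X J) *\<^sub>R X J) = A *\<^sub>R v"
      by (auto simp: tight_def)
    have op: "A *\<^sub>R v = ?t\<^sup>2 *\<^sub>R ((real r - real l) *\<^sub>R v + (real l * (v \<bullet> ?S)) *\<^sub>R ?S)" for v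
      using A[of v] unfolding X_def block_sums_frame_operator[OF D] T by simp
    have eS: "e i \<bullet> ?S = 1" if "i \<in> {1..n}" for i
      using inner_sum_equiangular[of "{1..n}" e 0 "{i}" "{1..n}", OF gram] that by simp
    \<comment> \<open>Orthogonal to \<open>?S\<close>, this vector kills the rank-one term, leaving
      the eigenvalue \<open>?t\<^sup>2 * (r - l)\<close>.\<close>
    let ?d = "e 1 - e 2"
    have "?d \<bullet> ?S = 0"
      using eS[of 1] eS[of 2] k by (simp add: inner_diff_left)
    then have "A *\<^sub>R ?d = (?t\<^sup>2 * (real r - real l)) *\<^sub>R ?d"
      using op[of ?d] by simp
    moreover have "?d \<noteq> 0"
      using gram[of 1 1] gram[of 1 2] k by auto
    ultimately have A1: "A = ?t\<^sup>2 * (real r - real l)"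
      by simp
    have SS: "?S \<bullet> ?S = real n"
      using inner_sum_equiangular[of "{1..n}" e 0 "{1..n}" "{1..n}", OF gram] by simp
    \<comment> \<open>On \<open>?S\<close> the rank-one term adds \<open>?t\<^sup>2 * l * n\<close>,
      which is nonzero since \<open>l\<close> is at least 1.\<close>
    have "A *\<^sub>R ?S = (?t\<^sup>2 * (real r - real l) + ?t\<^sup>2 * (real l * real n)) *\<^sub>R ?S"
      unfolding op[of ?S] SS by (simp only: scaleR_add_left scaleR_add_right scaleR_scaleR)
    moreover have "?S \<noteq> 0"
      using SS k by auto
    ultimately have "A = ?t\<^sup>2 * (real r - real l) + ?t\<^sup>2 * (real l * real n)"
      by (simp only: scaleR_cancel_right) simp
    then show False
      using A1 t k by simp
  qed
qed

text \<open>This is the case \<open>c = - 1 / (n - 1)\<close>. The scale is the one that gives unit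
  norm, and since the \<open>\<phi> i\<close> sum to zero the rank-one term disappears, leaving a
  multiple of the identity.\<close>

lemma block_sums_simplex:
  fixes \<phi> :: "nat \<Rightarrow> 'a::euclidean_space" and s :: real and n k x y :: nat
  defines "X \<equiv> \<lambda>J. sqrt ((real n - 1) / (real k * (real n - real k))) *\<^sub>R (\<Sum>i\<in>J. \<phi> i)"
    and "\<alpha> \<equiv> (real x * real n - (real k)\<^sup>2) / (real k * (real n - real k))"
    and "\<beta> \<equiv> (real y * real n - (real k)\<^sup>2) / (real k * (real n - real k))"
  assumes D: "two_design n \<B> b r k l" and Q: "quasi_symmetric \<B> x y"
    and s: "s = (real k * (real r - 1) - real x * (real b - 1)) / (real y - real x)"
    and S: "simplex_family n \<phi>"
  shows "balanced \<B> X"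
    and "two_distance_frame \<B> X \<alpha> \<beta>"
    and "tight \<B> X"
    and "has_multiplicity \<B> X \<alpha> (real b - s - 1)"
    and "has_multiplicity \<B> X \<beta> s"
proof -
  let ?t = "sqrt ((real n - 1) / (real k * (real n - real k)))" and ?c = "- 1 / (real n - 1)"
  have k: "2 \<le> k" "k < n" "1 \<le> l"
    using D by (auto simp: two_design_def)
  then have n: "2 \<le> n" and c: "?c < 1"
    by (auto simp: field_simps)
  have t: "?t\<^sup>2 = (real n - 1) / (real k * (real n - real k))" "?t \<noteq> 0"
    using k by simp_all
  have angle: "?t\<^sup>2 * ((1 - ?c) * real m + ?c * (real k)\<^sup>2)
      = (real m * real n - (real k)\<^sup>2) / (real k * (real n - real k))" for m
  proof -
    have "(real n - 1) * ((1 - ?c) * real m + ?c * (real k)\<^sup>2) = real m * real n - (real k)\<^sup>2"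
    proof -
      \<comment> \<open>Naming the denominator makes it an atom that can be cleared.\<close>
      define d where "d = real n - 1"
      have "real n = d + 1" "d \<noteq> 0"
        using n by (auto simp: d_def)
      then show ?thesis
        by (simp add: field_simps)
    qed
    then show ?thesis
      unfolding t by (metis times_divide_eq_left)
  qed
  have unit: "?t\<^sup>2 * ((1 - ?c) * real k + ?c * (real k)\<^sup>2) = 1"
    unfolding angle using k by (simp add: power2_eq_square algebra_simps)
  note two = block_sums_two_distance[OF D Q s simplex_gram[OF S] c unit
      angle[symmetric] angle[symmetric], folded X_def \<alpha>_def \<beta>_def]
  have T: "(\<Sum>i=1..n. (v \<bullet> \<phi> i) *\<^sub>R \<phi> i) = (real n / (real n - 1)) *\<^sub>R v" for v
    by (rule simplex_frame_operator[OF S n])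
  have "0 < real n / (real n - 1)"
    using n by simp
  then have "span (X ` \<B>) = UNIV"
    unfolding X_def by (rule block_sums_span[OF D t(2) _ T])
  then show "two_distance_frame \<B> X \<alpha> \<beta>"
    using two(1) by (simp add: two_distance_frame_def)
  show "has_multiplicity \<B> X \<alpha> (real b - s - 1)"
    by (rule two(2))
  show "has_multiplicity \<B> X \<beta> s"
    by (rule two(3))
  show "tight \<B> X"
    unfolding tight_def
  proof (intro exI conjI allI)
    \<comment> \<open>The frame bound simplifies to
      \<open>(r - l) * n / (k * (n - k))\<close>.\<close>
    show "0 < ?t\<^sup>2 * (real r - real l) * (real n / (real n - 1))"
      unfolding t using k two_design_less_replication[OF D] by simp
    show "(\<Sum>J\<in>\<B>. (v \<bullet> X J) *\<^sub>R X J) = (?t\<^sup>2 * (real r - real l) * (real n / (real n - 1))) *\<^sub>R v" for v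
      unfolding X_def block_sums_frame_operator[OF D] T simplex_sum_zero[OF S n]
      by (simp add: mult.assoc)
  qed
  \<comment> \<open>For balance, interchange the sums: each \<open>\<phi> i\<close> occurs once for
    each of the \<open>r\<close> blocks through \<open>i\<close>, so the total is \<open>r\<close>
    times the zero sum of the simplex.\<close>
  have "(\<Sum>J\<in>\<B>. \<Sum>i\<in>J. \<phi> i) = (\<Sum>J\<in>\<B>. \<Sum>i\<in>{1..n}. if i \<in> J then \<phi> i else 0)"
  proof (rule sum.cong[OF refl])
    fix J assume "J \<in> \<B>"
    then have "J \<subseteq> {1..n}"
      using D by (auto simp: two_design_def)
    then show "(\<Sum>i\<in>J. \<phi> i) = (\<Sum>i\<in>{1..n}. if i \<in> J then \<phi> i else 0)"
      by (intro sum.mono_neutral_cong_left) auto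
  qed
  also have "\<dots> = (\<Sum>i\<in>{1..n}. \<Sum>J\<in>\<B>. if i \<in> J then \<phi> i else 0)"
    by (rule sum.swap)
  also have "\<dots> = (\<Sum>i\<in>{1..n}. real r *\<^sub>R \<phi> i)"
  proof (rule sum.cong[OF refl])
    fix i assume "i \<in> {1..n}"
    then have r: "card {J \<in> \<B>. i \<in> J} = r"
      using D by (auto simp: two_design_def)
    have "(\<Sum>J\<in>\<B>. if i \<in> J then \<phi> i else 0) = (\<Sum>J\<in>{J \<in> \<B>. i \<in> J}. \<phi> i)"
      using two_design_finite[OF D] by (intro sum.mono_neutral_cong_right) auto
    then show "(\<Sum>J\<in>\<B>. if i \<in> J then \<phi> i else 0) = real r *\<^sub>R \<phi> i"
      using r by (simp add: sum_constant_scaleR del: sum_constant)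
  qed
  also have "\<dots> = 0"
    using simplex_sum_zero[OF S n] by (simp flip: scaleR_sum_right)
  finally show "balanced \<B> X"
    by (simp add: balanced_def X_def flip: scaleR_sum_right)
qed

theorem theorem3p9:
  fixes n b r k l x y :: nat and \<B> :: "nat set set" and s :: real
  assumes "two_design n \<B> b r k l"
    and "quasi_symmetric \<B> x y"
    and "s = (real k * (real r - 1) - real x * (real b - 1)) / (real y - real x)"
  shows
    "(\<forall>e :: nat \<Rightarrow> real ^ 'n. CARD('n) = n \<and> bij_betw e {1..n} Basis \<longrightarrow>
        (let X = (\<lambda>J. (1 / sqrt (real k)) *\<^sub>R (\<Sum>i\<in>J. e i));
             \<alpha> = real x / real k;
             \<beta> = real y / real k
         in two_distance_frame \<B> X \<alpha> \<beta> \<and>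
            regular_two_distance_set \<B> X \<alpha> \<beta> \<and>
            has_multiplicity \<B> X \<alpha> (real b - s - 1) \<and>
            has_multiplicity \<B> X \<beta> s \<and>
            \<not> tight \<B> X)) \<and>
     (\<forall>\<phi> :: nat \<Rightarrow> real ^ 'm. CARD('m) = n - 1 \<and> simplex_family n \<phi> \<longrightarrow>
        (let X = (\<lambda>J. sqrt ((real n - 1) / (real k * (real n - real k))) *\<^sub>R (\<Sum>i\<in>J. \<phi> i));
             \<alpha> = (real x * real n - (real k)\<^sup>2) / (real k * (real n - real k));
             \<beta> = (real y * real n - (real k)\<^sup>2) / (real k * (real n - real k))
         in balanced \<B> X \<and>
            two_distance_frame \<B> X \<alpha> \<beta> \<and>
            tight \<B> X \<and>
            regular_two_distance_set \<B> X \<alpha> \<beta> \<and>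
            has_multiplicity \<B> X \<alpha> (real b - s - 1) \<and>
            has_multiplicity \<B> X \<beta> s))"
proof (intro conjI allI impI, goal_cases)
  case (1 e)
  then have e: "bij_betw e {1..n} Basis"
    by blast
  note block_sums_orthonormal[OF assms e]
  then show ?case
    \<comment> \<open>Regularity asks for the existence of multiplicities; \<open>b - s - 1\<close>
      and \<open>s\<close> are the witnesses.\<close>
    unfolding Let_def regular_two_distance_set_def two_distance_frame_def by blast
next
  case (2 \<phi>)
  then have S: "simplex_family n \<phi>"
    by blast
  note block_sums_simplex[OF assms S]
  then show ?case
    unfolding Let_def regular_two_distance_set_def two_distance_frame_def by blast
qed

end
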